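(* Let $D$ be a weighted oriented graph such that $I(D)\subseteq (x_{i_1}^{w_{i_1}},\ldots,x_{i_s}^{w_{i_s}})$, where $x_{i_1},\ldots,x_{i_s}$ are distinct vertices of $D$, $w_{i_j}=w(x_{i_j})$, and where $s$ is the least possible value in the sense that $I(D)$ is not contained in the ideal $(x^{w(x)}\mid x\in S)$ for any proper subset $S\subsetneq\{x_{i_1},\ldots,x_{i_s}\}$. Then $\{x_{i_1},\ldots,x_{i_s}\}$ is a maximal strong vertex cover of $D$.
   Context: A weighted oriented graph $D=(V(D),E(D),w)$ has a finite simple underlying graph (assumed connected), each edge $\{x,y\}$ given exactly one orientation, $(x,y)\in E(D)$ meaning $x\to y$, and a weight function $w:V(D)\to\mathbb N=\{1,2,\ldots\}$. Convention: every source vertex (a vertex with no incoming edge) has weight $1$. Let $k$ be a field; vertices are identified with variables of a polynomial ring $R$ over $k$. The edge ideal is $I(D)=(xy^{w(y)}\mid (x,y)\in E(D))\subseteq R$. $N_D^+(x)=\{y\mid (x,y)\in E(D)\}$, $N_D^-(x)=\{y\mid (y,x)\in E(D)\}$, and $V^+(D)$ is the set of vertices with $w\neq 1$. A vertex cover of $D$ is a set $C\subseteq V(D)$ such that for each $(x,y)\in E(D)$, $x\in C$ or $y\in C$. With $C^c=V(D)\setminus C$ put $L_1^D(C)=\{x\in C\mid N_D^+(x)\cap C^c\neq\emptyset\}$, $L_2^D(C)=\{x\in C\mid x\notin L_1^D(C),\ N_D^-(x)\cap C^c\neq\emptyset\}$, $L_3^D(C)=C\setminus(L_1^D(C)\cup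 L_2^D(C))$. A vertex cover $C$ is strong if for each $x\in L_3^D(C)$ there is $(y,x)\in E(D)$ with $y\in L_2^D(C)\cup L_3^D(C)$ and $y\in V^+(D)$. A strong vertex cover is maximal if it is not contained in any other strong vertex cover of $D$. *)

theory Defs
  imports "Graph_Theory.Pair_Digraph" "Graph_Theory.Digraph_Component"
    "HOL-Library.Poly_Mapping"
begin

section \<open>Polynomial rings and ideals\<close>

text \<open>
  Polynomials over \<open>'k\<close> in the variables \<open>'v\<close>: finitely supported maps from exponent
  vectors to coefficients, with the convolution product of \<^theory>\<open>HOL-Library.Poly_Mapping\<close>.
  Every element of \<open>'v\<close> is a variable; the vertices of a graph may form a proper subset.
\<close>

type_synonym ('v, 'k) polynomial = "('v \<Rightarrow>\<^sub>0 nat) \<Rightarrow>\<^sub>0 'k"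

definition Var :: "'v \<Rightarrow> ('v, 'k::field) polynomial" where
  "Var x = Poly_Mapping.single (Poly_Mapping.single x 1) 1"

text \<open>
  A commutative ring is a module over itself, and its submodules are its ideals, so the ideal
  generated by a set is the span of that set.
\<close>

lemma module_mult: "module ((*) :: 'a::comm_ring_1 \<Rightarrow> 'a \<Rightarrow> 'a)"
  by unfold_locales (simp_all add: algebra_simps)

definition ideal_generated :: "'a::comm_ring_1 set \<Rightarrow> 'a set" where
  "ideal_generated A = module.span (*) A"


section \<open>Weighted oriented graphs\<close>

text \<open>
  The edge \<open>x \<rightarrow> y\<close> is the pair \<open>(x, y) \<in> parcs D\<close>. The locale \<^locale>\<open>pair_digraph\<close> supplies
  finiteness, absence of loops, and that arcs run between vertices; \<open>oriented\<close> excludes opposite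
  arcs, so that the underlying graph is simple and each of its edges has one orientation.
\<close>

locale weighted_oriented_graph = pair_digraph D
  for D :: "'v pair_pre_digraph" +
  fixes w :: "'v \<Rightarrow> nat"
  assumes oriented: "(x, y) \<in> parcs D \<Longrightarrow> (y, x) \<notin> parcs D"
    and underlying_connected: "Digraph_Component.connected (with_proj D)"
    and weight_pos: "x \<in> pverts D \<Longrightarrow> 1 \<le> w x"
    and source_weight: "x \<in> pverts D \<Longrightarrow> (\<And>y. (y, x) \<notin> parcs D) \<Longrightarrow> w x = 1"

definition edge_ideal :: "'v pair_pre_digraph \<Rightarrow> ('v \<Rightarrow> nat) \<Rightarrow> ('v, 'k::field) polynomial set" where
  "edge_ideal D w = ideal_generated {Var x * Var y ^ w y | x y. (x, y) \<in> parcs D}"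

definition weighted_vertex_ideal :: "('v \<Rightarrow> nat) \<Rightarrow> 'v set \<Rightarrow> ('v, 'k::field) polynomial set" where
  "weighted_vertex_ideal w S = ideal_generated {Var x ^ w x | x. x \<in> S}"

definition out_nbrs :: "'v pair_pre_digraph \<Rightarrow> 'v \<Rightarrow> 'v set" where
  "out_nbrs D x = {y. (x, y) \<in> parcs D}"

definition in_nbrs :: "'v pair_pre_digraph \<Rightarrow> 'v \<Rightarrow> 'v set" where
  "in_nbrs D x = {y. (y, x) \<in> parcs D}"

definition Vplus :: "'v pair_pre_digraph \<Rightarrow> ('v \<Rightarrow> nat) \<Rightarrow> 'v set" where
  "Vplus D w = {x \<in> pverts D. w x \<noteq> 1}"


section \<open>Strong vertex covers\<close>

definition vertex_cover :: "'v pair_pre_digraph \<Rightarrow> 'v set \<Rightarrow> bool" where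
  "vertex_cover D C \<longleftrightarrow> C \<subseteq> pverts D \<and> (\<forall>(x, y) \<in> parcs D. x \<in> C \<or> y \<in> C)"

definition L1 :: "'v pair_pre_digraph \<Rightarrow> 'v set \<Rightarrow> 'v set" where
  "L1 D C = {x \<in> C. out_nbrs D x \<inter> (pverts D - C) \<noteq> {}}"

definition L2 :: "'v pair_pre_digraph \<Rightarrow> 'v set \<Rightarrow> 'v set" where
  "L2 D C = {x \<in> C. x \<notin> L1 D C \<and> in_nbrs D x \<inter> (pverts D - C) \<noteq> {}}"

definition L3 :: "'v pair_pre_digraph \<Rightarrow> 'v set \<Rightarrow> 'v set" where
  "L3 D C = C - (L1 D C \<union> L2 D C)"

definition strong_vertex_cover :: "'v pair_pre_digraph \<Rightarrow> ('v \<Rightarrow> nat) \<Rightarrow> 'v set \<Rightarrow> bool" where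
  "strong_vertex_cover D w C \<longleftrightarrow> vertex_cover D C \<and>
     (\<forall>x \<in> L3 D C. \<exists>y. (y, x) \<in> parcs D \<and> y \<in> L2 D C \<union> L3 D C \<and> y \<in> Vplus D w)"

definition maximal_strong_vertex_cover :: "'v pair_pre_digraph \<Rightarrow> ('v \<Rightarrow> nat) \<Rightarrow> 'v set \<Rightarrow> bool" where
  "maximal_strong_vertex_cover D w C \<longleftrightarrow> strong_vertex_cover D w C \<and>
     \<not> (\<exists>C'. strong_vertex_cover D w C' \<and> C \<subset> C')"

end

theory Submission
  imports Defs
begin

text \<open>
  All ideals here are generated by monomials, so the containment of the edge ideal in
  \<open>(x\<^bsup>w x\<^esup> | x \<in> S)\<close> can be decided one edge at a time: some \<open>z\<^bsup>w z\<^esup>\<close> with \<open>z \<in> S\<close> has to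
  divide \<open>x y\<^bsup>w y\<^esup>\<close>. Since \<open>x \<noteq> y\<close>, this leaves the two possibilities \<open>z = y\<close>, or \<open>z = x\<close> with
  \<open>w x = 1\<close>. The theorem thereby becomes a statement about sets that meet every edge
  \<open>x \<rightarrow> y\<close> in \<open>y\<close>, or in \<open>x\<close> with \<open>w x = 1\<close> (\<open>edge_ideal_subset_iff\<close>).

  Let \<open>X\<close> be minimal with this property. A vertex \<open>u \<in> X\<close> of weight other than \<open>1\<close> cannot cover
  its out-edges itself, so its out-neighbours all lie in \<open>X\<close>, that is, \<open>u \<notin> L1\<close>. By minimality,
  every \<open>x \<in> X\<close> is the only possible cover of some edge. When \<open>x \<in> L3\<close>, all neighbours of \<open>x\<close>
  are in \<open>X\<close>, and the edge can only be \<open>u \<rightarrow> x\<close> with \<open>u \<in> X\<close> and \<open>w u \<noteq> 1\<close>; this \<open>u\<close> is what a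
  strong cover asks for. Maximality holds because a vertex \<open>x\<close> outside \<open>X\<close> has all its
  neighbours in \<open>X\<close> and all its in-neighbours of weight \<open>1\<close>. In a larger cover \<open>x\<close> would thus
  belong to \<open>L3\<close>, but no in-neighbour of \<open>x\<close> has weight other than \<open>1\<close>.
\<close>

lemma Var_power:
  "(Var x :: ('v, 'k::field) polynomial) ^ n = Poly_Mapping.single (Poly_Mapping.single x n) 1"
proof (induction n)
  case 0
  show ?case by simp
next
  case (Suc n)
  then show ?case
    by (simp add: Var_def mult_single flip: single_add)
qed

text \<open>
  The polynomials all of whose monomials are divisible by some \<open>z\<^bsup>w z\<^esup>\<close> with \<open>z \<in> S\<close> form an
  ideal that contains the generators. This is the half of the description of a monomial ideal by
  divisibility that serves to refute membership.
\<close>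

lemma weighted_vertex_ideal_monomial:
  fixes p :: "('v, 'k::field) polynomial"
  assumes "p \<in> weighted_vertex_ideal w S" and "t \<in> Poly_Mapping.keys p"
  shows "\<exists>z\<in>S. w z \<le> Poly_Mapping.lookup t z"
proof -
  let ?G = "{Var x ^ w x | x. x \<in> S} :: ('v, 'k) polynomial set"
  let ?Q = "{p :: ('v, 'k) polynomial.
    \<forall>t\<in>Poly_Mapping.keys p. \<exists>z\<in>S. w z \<le> Poly_Mapping.lookup t z}"
  have gens: "?G \<subseteq> ?Q"
    by (auto simp: Var_power intro!: bexI)
  have "module.subspace (*) ?Q"
    unfolding module.subspace_def[OF module_mult]
  proof (intro conjI ballI allI)
    show "0 \<in> ?Q" by simp
  next
    fix p q assume "p \<in> ?Q" "q \<in> ?Q"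
    then show "p + q \<in> ?Q"
      using Poly_Mapping.keys_add[of p q] by blast
  next
    fix c p assume p: "p \<in> ?Q"
    show "c * p \<in> ?Q"
    proof (intro CollectI ballI)
      fix t assume "t \<in> Poly_Mapping.keys (c * p)"
      then obtain a b where "t = a + b" "b \<in> Poly_Mapping.keys p"
        using keys_mult[of c p] by blast
      with p show "\<exists>z\<in>S. w z \<le> Poly_Mapping.lookup t z"
        by (fastforce simp: lookup_add intro: trans_le_add2)
    qed
  qed
  then have "weighted_vertex_ideal w S \<subseteq> ?Q"
    using module.span_minimal[OF module_mult gens]
    by (simp add: weighted_vertex_ideal_def ideal_generated_def)
  with assms show ?thesis by blast
qed

text \<open>
  Divisibility of \<open>x y\<^bsup>w y\<^esup>\<close> by \<open>z\<^bsup>w z\<^esup>\<close>: positivity of \<open>w z\<close> forces \<open>z\<close> to be \<open>x\<close> or \<open>y\<close>, and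
  \<open>x\<close> occurs in the monomial with exponent \<open>1\<close>.
\<close>

lemma edge_monomial_mem_iff:
  assumes "x \<noteq> y" and pos: "\<And>z. z \<in> S \<Longrightarrow> 1 \<le> w z"
  shows "(Var x * Var y ^ w y :: ('v, 'k::field) polynomial) \<in> weighted_vertex_ideal w S
    \<longleftrightarrow> y \<in> S \<or> x \<in> S \<and> w x = 1" (is "?m \<in> ?I \<longleftrightarrow> _")
proof
  let ?t = "Poly_Mapping.single x 1 + Poly_Mapping.single y (w y)"
  assume "?m \<in> ?I"
  moreover have "?m = Poly_Mapping.single ?t 1"
    by (simp add: Var_power) (simp add: Var_def mult_single)
  ultimately obtain z where z: "z \<in> S" "w z \<le> Poly_Mapping.lookup ?t z"
    using weighted_vertex_ideal_monomial[of ?m w S ?t] by auto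
  then show "y \<in> S \<or> x \<in> S \<and> w x = 1"
    using pos[OF z(1)] \<open>x \<noteq> y\<close>
    by (auto simp: lookup_add lookup_single when_def split: if_splits)
next
  have gen: "(Var z ^ w z :: ('v, 'k) polynomial) \<in> ?I" if "z \<in> S" for z
    unfolding weighted_vertex_ideal_def ideal_generated_def
    using that by (intro module.span_base[OF module_mult]) blast
  have scale: "c * p \<in> ?I" if "p \<in> ?I" for c p :: "('v, 'k) polynomial"
    using that module.span_scale[OF module_mult]
    unfolding weighted_vertex_ideal_def ideal_generated_def by blast
  assume "y \<in> S \<or> x \<in> S \<and> w x = 1"
  then show "?m \<in> ?I"
  proof
    assume "y \<in> S"
    then show ?thesis by (intro scale gen)
  next
    assume "x \<in> S \<and> w x = 1"
    then have "Var y ^ w y * Var x \<in> ?I"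
      using gen[of x] by (intro scale) simp
    then show ?thesis by (simp add: mult.commute)
  qed
qed

lemma ideal_generated_subset_iff:
  "ideal_generated A \<subseteq> ideal_generated B \<longleftrightarrow> A \<subseteq> ideal_generated B"
proof
  assume "ideal_generated A \<subseteq> ideal_generated B"
  then show "A \<subseteq> ideal_generated B"
    unfolding ideal_generated_def
    using module.span_superset[OF module_mult, of A] by blast
next
  assume "A \<subseteq> ideal_generated B"
  then show "ideal_generated A \<subseteq> ideal_generated B"
    unfolding ideal_generated_def
    by (rule module.span_minimal[OF module_mult _ module.subspace_span[OF module_mult]])
qed

context weighted_oriented_graph
begin

lemma edge_ideal_subset_iff:
  assumes "S \<subseteq> pverts D"
  shows "(edge_ideal D w :: ('v, 'k::field) polynomial set) \<subseteq> weighted_vertex_ideal w S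
    \<longleftrightarrow> (\<forall>(x, y) \<in> parcs D. y \<in> S \<or> x \<in> S \<and> w x = 1)"
proof -
  have "(edge_ideal D w :: ('v, 'k) polynomial set) \<subseteq> weighted_vertex_ideal w S
    \<longleftrightarrow> (\<forall>(x, y) \<in> parcs D.
          (Var x * Var y ^ w y :: ('v, 'k) polynomial) \<in> weighted_vertex_ideal w S)"
    unfolding edge_ideal_def weighted_vertex_ideal_def ideal_generated_subset_iff by blast
  also have "\<dots> \<longleftrightarrow> (\<forall>(x, y) \<in> parcs D. y \<in> S \<or> x \<in> S \<and> w x = 1)"
  proof (intro ball_cong refl, clarify)
    fix x y assume "(x, y) \<in> parcs D"
    then have "x \<noteq> y" using oriented by blast
    then show "(Var x * Var y ^ w y :: ('v, 'k) polynomial) \<in> weighted_vertex_ideal w S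
        \<longleftrightarrow> y \<in> S \<or> x \<in> S \<and> w x = 1"
      using assms by (intro edge_monomial_mem_iff weight_pos) auto
  qed
  finally show ?thesis .
qed

lemma arc_in_pverts:
  assumes "(x, y) \<in> parcs D"
  shows "x \<in> pverts D" "y \<in> pverts D"
  using arc_fst_in_verts[OF assms] arc_snd_in_verts[OF assms] by simp_all

end

theorem lemma6p2:
  fixes D :: "'v pair_pre_digraph" and w :: "'v \<Rightarrow> nat" and X :: "'v set"
  assumes "weighted_oriented_graph D w"
    and "X \<subseteq> pverts D"
    and "(edge_ideal D w :: ('v, 'k::field) polynomial set) \<subseteq> weighted_vertex_ideal w X"
    and "\<And>S. S \<subset> X \<Longrightarrow>
      \<not> (edge_ideal D w :: ('v, 'k) polynomial set) \<subseteq> weighted_vertex_ideal w S"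
  shows "maximal_strong_vertex_cover D w X"
proof -
  interpret weighted_oriented_graph D w by fact
  have cov: "y \<in> X \<or> x \<in> X \<and> w x = 1" if "(x, y) \<in> parcs D" for x y
    using assms(3) edge_ideal_subset_iff[OF assms(2), where 'k='k] that by blast
  have crit: "\<exists>(u, v) \<in> parcs D. v \<notin> X - {x} \<and> \<not> (u \<in> X - {x} \<and> w u = 1)"
    if "x \<in> X" for x
  proof -
    have "X - {x} \<subset> X" using that by blast
    moreover have "X - {x} \<subseteq> pverts D" using assms(2) by blast
    ultimately show ?thesis
      using assms(4)[of "X - {x}"] edge_ideal_subset_iff[of "X - {x}", where 'k='k] by blast
  qed
  have "strong_vertex_cover D w X"
    unfolding strong_vertex_cover_def
  proof (intro conjI ballI)
    show "vertex_cover D X"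
      unfolding vertex_cover_def using assms(2) cov by blast
  next
    fix x assume "x \<in> L3 D X"
    then have x: "x \<in> X" and nbrs: "\<And>y. (x, y) \<in> parcs D \<Longrightarrow> y \<in> X"
        "\<And>y. (y, x) \<in> parcs D \<Longrightarrow> y \<in> X"
      using arc_in_pverts by (auto simp: L3_def L2_def L1_def out_nbrs_def in_nbrs_def)
    from crit[OF x] obtain u v where uv: "(u, v) \<in> parcs D"
      "v \<notin> X - {x}" "\<not> (u \<in> X - {x} \<and> w u = 1)" by blast
    \<comment> \<open>An edge with head outside \<open>X\<close> has its tail in \<open>X\<close>; if \<open>x\<close> were that tail, the head would
      be a neighbour of \<open>x\<close>, hence in \<open>X\<close>.\<close>
    have "v = x" using uv cov[OF uv(1)] nbrs(1) by blast
    moreover have "u \<noteq> v" using uv(1) oriented by blast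
    ultimately have u: "(u, x) \<in> parcs D" "u \<in> X" "w u \<noteq> 1"
      using uv nbrs(2) by auto
    have "u \<notin> L1 D X"
      using cov u(3) by (auto simp: L1_def out_nbrs_def)
    then have "u \<in> L2 D X \<union> L3 D X" using u(2) by (auto simp: L3_def)
    moreover have "u \<in> Vplus D w"
      using u assms(2) by (auto simp: Vplus_def)
    ultimately show "\<exists>y. (y, x) \<in> parcs D \<and> y \<in> L2 D X \<union> L3 D X \<and> y \<in> Vplus D w"
      using u(1) by blast
  qed
  moreover have False if C: "strong_vertex_cover D w C" and "X \<subset> C" for C
  proof -
    obtain x where x: "x \<in> C" "x \<notin> X" using \<open>X \<subset> C\<close> by blast
    have out_X: "y \<in> X" if "(x, y) \<in> parcs D" for y
      using cov[OF that] x(2) by blast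
    have in_X: "y \<in> X \<and> w y = 1" if "(y, x) \<in> parcs D" for y
      using cov[OF that] x(2) by blast
    have "x \<in> L3 D C"
      using x(1) out_X in_X \<open>X \<subset> C\<close>
      by (auto simp: L3_def L2_def L1_def out_nbrs_def in_nbrs_def)
    then obtain y where "(y, x) \<in> parcs D" "y \<in> Vplus D w"
      using C unfolding strong_vertex_cover_def by blast
    then show False using in_X by (auto simp: Vplus_def)
  qed
  ultimately show ?thesis
    unfolding maximal_strong_vertex_cover_def by blast
qed

end
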